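(* Consider a satellite at altitude $h>0$ above the plane $\mathbb{P}$, and let $s_t\ge h$ be its slant range at time $t$ relative to the center of a cluster of radius $\rho>0$ in $\mathbb{P}$. Put $\hat R_t=\sqrt{s_t^2-h^2}$ and $A=\frac{f_c\, r_o\,(\omega_s+\omega_E\cos\theta_i)}{c}>0$. Let $|\chi_t|$ be the Doppler shift magnitude (in the model described in the context) at a UE located uniformly at random in the cluster. Then $|\chi_t|$ has a probability density function given, for $0\le x<A$, by $$f^{t}_{\chi,\mathrm{M}}(x)=\frac{hA^2}{(A^2-x^2)^{3/2}}\,f_{\mathrm{M}}\!\left(\frac{hx}{\sqrt{A^2-x^2}},\ \rho\ \Big|\ \hat R_t\right)$$ (and zero for other $x$), where, for $r\ge0$, $R>0$, $\hat R\ge0$, $$f_{\mathrm{M}}(r,R\,|\,\hat R)=\begin{cases}\frac{2r}{R^2}, & 0\le r\le R-\hat R,\\[2pt] \frac{2r}{\pi R^2}\cos^{-1}\!\left[\frac{r^2+\hat R^2-R^2}{2\hat R r}\right], & |R-\hat R|<r\le R+\hat R,\end{cases}$$ and $f_{\mathrm{M}}(r,R\,|\,\hat R)=0$ for all other $r\ge 0$.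
   Context: Setting: UEs (user equipments) lie on a plane $\mathbb{P}$ (flat-earth approximation). A satellite at altitude $h$ has orthogonal projection $\mathcal{P}_t$ (the sub-satellite point) on $\mathbb{P}$ at time $t$. The cluster is the disk of radius $\rho$ in $\mathbb{P}$ about a cluster center; the slant range $s_t$ is the Euclidean distance from the satellite to the cluster center, so $\hat R_t=\sqrt{s_t^2-h^2}$ is the distance from $\mathcal{P}_t$ to the cluster center. The satellite location and cluster center are fixed; the UE is uniformly distributed in the disk. Parameters (positive constants unless stated): carrier frequency $f_c$, speed of light $c$, earth radius $r_E$, orbital radius $r_o=r_E+h$, angular velocities $\omega_s$ (satellite) and $\omega_E$ (earth), orbital inclination $\theta_i\in\mathbb{R}$, and $\omega_F=\omega_s+\omega_E\cos\theta_i>0$. Doppler model: if $z_t$ is the distance in $\mathbb{P}$ from the UE to $\mathcal{P}_t$, then the Doppler shift magnitude at the UE is $|\chi_t|=\frac{f_c r_E\omega_F}{c}\,\kappa_t$, where $\kappa_t=\frac{r_o z_t}{r_E\sqrt{h^2+z_t^2}}$ is the (flat-earth) expression used for the cosine of the elevation angle from the UE to the satellite. *)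

theory Defs
  imports "HOL-Probability.Probability"
begin

text \<open>
  Coordinates on Euclidean 3-space are chosen so that the plane carrying the UEs is the set of
  points \<open>(p, 0)\<close>. The library metric on product types is the Euclidean one, so \<^const>\<open>dist\<close> is the
  Euclidean distance on both types. The satellite at altitude \<open>h\<close> with sub-satellite point \<open>p\<close> is
  the point \<open>(p, h)\<close>.
\<close>

type_synonym plane = "real \<times> real"
type_synonym space = "plane \<times> real"

definition slant_range :: "plane \<Rightarrow> real \<Rightarrow> plane \<Rightarrow> real" where
  "slant_range p h q = dist ((p, h) :: space) (q, 0)"

text \<open>The flat-earth expression used for the cosine of the elevation angle, where \<open>z\<close> is the
  distance in the plane from the UE to the sub-satellite point.\<close>

definition cos_elevation :: "real \<Rightarrow> real \<Rightarrow> real \<Rightarrow> real" where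
  "cos_elevation r\<^sub>E h z = (r\<^sub>E + h) * z / (r\<^sub>E * sqrt (h\<^sup>2 + z\<^sup>2))"

definition doppler_magnitude ::
    "real \<Rightarrow> real \<Rightarrow> real \<Rightarrow> real \<Rightarrow> real \<Rightarrow> plane \<Rightarrow> plane \<Rightarrow> real" where
  "doppler_magnitude f\<^sub>c c r\<^sub>E \<omega>\<^sub>F h p u = f\<^sub>c * r\<^sub>E * \<omega>\<^sub>F / c * cos_elevation r\<^sub>E h (dist u p)"

text \<open>The case \<open>Rh = 0\<close> never reaches the quotient by \<open>2 * Rh * r\<close>: its second range is empty.\<close>

definition f_M :: "real \<Rightarrow> real \<Rightarrow> real \<Rightarrow> real" where
  "f_M r R Rh =
    (if 0 \<le> r \<and> r \<le> R - Rh then 2 * r / R\<^sup>2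
     else if \<bar>R - Rh\<bar> < r \<and> r \<le> R + Rh
       then 2 * r / (pi * R\<^sup>2) * arccos ((r\<^sup>2 + Rh\<^sup>2 - R\<^sup>2) / (2 * Rh * r))
     else 0)"

definition f_chi_M :: "real \<Rightarrow> real \<Rightarrow> real \<Rightarrow> real \<Rightarrow> real \<Rightarrow> real" where
  "f_chi_M h A \<rho> Rh x =
    (if 0 \<le> x \<and> x < A
     then h * A\<^sup>2 / (A\<^sup>2 - x\<^sup>2) powr (3/2) * f_M (h * x / sqrt (A\<^sup>2 - x\<^sup>2)) \<rho> Rh
     else 0)"

end

theory Submission
  imports Defs
begin

text \<open>
  The law of the distance \<open>r\<close> from the UE to the sub-satellite point is read off in polar coordinates
  about that point: the density at \<open>r\<close> is proportional to the angular measure of the part of the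
  circle of radius \<open>r\<close> inside the cluster. Polar coordinates are obtained without a two-dimensional
  change of variables. Substituting \<open>y = x t\<close> for fixed \<open>x\<close>, and then \<open>x = r / sqrt (1 + t\<^sup>2)\<close> for
  fixed \<open>t\<close>, are linear substitutions in one variable; the angle becomes the Cauchy measure
  \<open>dt / (1 + t\<^sup>2)\<close>, and the two signs of \<open>r\<close> give the two half planes. The Doppler magnitude is the
  increasing function \<open>A r / sqrt (h\<^sup>2 + r\<^sup>2)\<close> of \<open>r\<close>, so its density follows by one more substitution.
\<close>

section \<open>Substitution rules on the line and the plane, up to polar coordinates\<close>

lemma nn_integral_plane:
  fixes f :: "real \<times> real \<Rightarrow> ennreal"
  assumes [measurable]: "f \<in> borel_measurable borel"
  shows "(\<integral>\<^sup>+z. f z \<partial>lborel) = (\<integral>\<^sup>+x. \<integral>\<^sup>+y. f (x, y) \<partial>lborel \<partial>lborel)"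
    and "(\<integral>\<^sup>+z. f z \<partial>lborel) = (\<integral>\<^sup>+y. \<integral>\<^sup>+x. f (x, y) \<partial>lborel \<partial>lborel)"
proof -
  have m: "f \<in> borel_measurable (lborel \<Otimes>\<^sub>M lborel)"
    by (simp add: lborel_prod)
  show "(\<integral>\<^sup>+z. f z \<partial>lborel) = (\<integral>\<^sup>+x. \<integral>\<^sup>+y. f (x, y) \<partial>lborel \<partial>lborel)"
    using lborel.nn_integral_fst[OF m] by (simp add: lborel_prod)
  show "(\<integral>\<^sup>+z. f z \<partial>lborel) = (\<integral>\<^sup>+y. \<integral>\<^sup>+x. f (x, y) \<partial>lborel \<partial>lborel)"
    using lborel_pair.nn_integral_snd[OF m] by (simp add: lborel_prod)
qed

lemma nn_integral_lborel_affine: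
  fixes f :: "real \<Rightarrow> ennreal" and c t :: real
  assumes [measurable]: "f \<in> borel_measurable borel" and "c \<noteq> 0"
  shows "(\<integral>\<^sup>+x. f x \<partial>lborel) = (\<integral>\<^sup>+x. ennreal \<bar>c\<bar> * f (t + c * x) \<partial>lborel)"
  using assms(2) by (simp add: nn_integral_real_affine[OF assms, of t] nn_integral_cmult)

text \<open>For \<open>c \<noteq> 0\<close> the rotation is a composition of two one-variable affine
  substitutions: first in \<open>x\<close> with \<open>y\<close> fixed, then in \<open>y\<close>
  with \<open>x\<close> fixed. Their Jacobians \<open>1/\<bar>c\<bar>\<close> and
  \<open>\<bar>c\<bar>\<close> cancel. For \<open>c = 0\<close> it is an exchange of the axes with
  signs.\<close>

lemma nn_integral_rotate:
  fixes f :: "real \<times> real \<Rightarrow> ennreal" and c s :: real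
  assumes [measurable]: "f \<in> borel_measurable borel" and cs: "c\<^sup>2 + s\<^sup>2 = 1"
  shows "(\<integral>\<^sup>+z. f z \<partial>lborel)
    = (\<integral>\<^sup>+x. \<integral>\<^sup>+y. f (c * x - s * y, s * x + c * y) \<partial>lborel \<partial>lborel)"
proof (cases "c = 0")
  case True
  then have s: "\<bar>s\<bar> = 1" using cs by (simp add: abs_square_eq_1)
  then have s0: "s \<noteq> 0" by auto
  \<comment> \<open>The outer variable \<open>y\<close> plays the part of \<open>x\<close> in the
    statement, so the exchange of axes is just the other order of integration.\<close>
  have "(\<integral>\<^sup>+z. f z \<partial>lborel) = (\<integral>\<^sup>+y. \<integral>\<^sup>+x. f (x, y) \<partial>lborel \<partial>lborel)"
    by (rule nn_integral_plane) simp
  also have "\<dots> = (\<integral>\<^sup>+y. \<integral>\<^sup>+x. f (- s * x, y) \<partial>lborel \<partial>lborel)"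
  proof (rule nn_integral_cong)
    fix y :: real
    show "(\<integral>\<^sup>+x. f (x, y) \<partial>lborel) = (\<integral>\<^sup>+x. f (- s * x, y) \<partial>lborel)"
      using nn_integral_lborel_affine[of "\<lambda>x. f (x, y)" "- s" 0] s s0 by simp
  qed
  also have "\<dots> = (\<integral>\<^sup>+y. \<integral>\<^sup>+x. f (- s * x, s * y) \<partial>lborel \<partial>lborel)"
    using nn_integral_lborel_affine[of "\<lambda>y. \<integral>\<^sup>+x. f (- s * x, y) \<partial>lborel" "s" 0] s s0 by simp
  finally show ?thesis using True by simp
next
  case False
  have "(\<integral>\<^sup>+z. f z \<partial>lborel) = (\<integral>\<^sup>+y. \<integral>\<^sup>+x. f (x, y) \<partial>lborel \<partial>lborel)"
    by (rule nn_integral_plane) simp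
  also have "\<dots> = (\<integral>\<^sup>+y. \<integral>\<^sup>+x. ennreal (1/\<bar>c\<bar>) * f ((x - s * y) / c, y) \<partial>lborel \<partial>lborel)"
  proof (rule nn_integral_cong)
    fix y :: real
    have "- s * y / c + 1 / c * x = (x - s * y) / c" for x
      using False by (simp add: field_simps)
    then show "(\<integral>\<^sup>+x. f (x, y) \<partial>lborel)
        = (\<integral>\<^sup>+x. ennreal (1/\<bar>c\<bar>) * f ((x - s * y) / c, y) \<partial>lborel)"
      using nn_integral_lborel_affine[of "\<lambda>x. f (x, y)" "1/c" "- s * y / c"] False
      by simp
  qed
  also have "\<dots> = (\<integral>\<^sup>+x. \<integral>\<^sup>+y. ennreal (1/\<bar>c\<bar>) * f ((x - s * y) / c, y) \<partial>lborel \<partial>lborel)"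
    by (rule lborel_pair.Fubini') simp
  also have "\<dots> = (\<integral>\<^sup>+x. \<integral>\<^sup>+y. f (c * x - s * y, s * x + c * y) \<partial>lborel \<partial>lborel)"
  proof (rule nn_integral_cong)
    fix x :: real
    \<comment> \<open>This is where the determinant condition
      \<open>c\<^sup>2 + s\<^sup>2 = 1\<close> enters: it makes the second substitution turn the
      sheared first coordinate into the rotated one.\<close>
    have e: "(x - s * (s * x + c * y)) / c = c * x - s * y" for y
    proof -
      have "x - s * (s * x + c * y) = (1 - s\<^sup>2) * x - s * c * y"
        by (simp add: power2_eq_square algebra_simps)
      also have "1 - s\<^sup>2 = c\<^sup>2" using cs by simp
      also have "c\<^sup>2 * x - s * c * y = c * (c * x - s * y)"
        by (simp add: power2_eq_square algebra_simps)
      finally show ?thesis using False by simp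
    qed
    have "(\<integral>\<^sup>+y. ennreal (1/\<bar>c\<bar>) * f ((x - s * y) / c, y) \<partial>lborel)
      = (\<integral>\<^sup>+y. ennreal \<bar>c\<bar> * (ennreal (1/\<bar>c\<bar>) * f (c * x - s * y, s * x + c * y)) \<partial>lborel)"
      using nn_integral_lborel_affine[of "\<lambda>y. ennreal (1/\<bar>c\<bar>) * f ((x - s * y) / c, y)" c "s * x"] False
      by (simp only: e) simp
    also have "\<dots> = (\<integral>\<^sup>+y. f (c * x - s * y, s * x + c * y) \<partial>lborel)"
      using False by (simp flip: mult.assoc ennreal_mult)
    finally show "(\<integral>\<^sup>+y. ennreal (1/\<bar>c\<bar>) * f ((x - s * y) / c, y) \<partial>lborel)
      = (\<integral>\<^sup>+y. f (c * x - s * y, s * x + c * y) \<partial>lborel)" .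
  qed
  finally show ?thesis .
qed

text \<open>Here \<open>r\<close> is a signed radius carrying the sign of the first coordinate, and
  \<open>t\<close> is the slope of the line through the origin. The weight collects
  \<open>\<bar>x\<bar> = \<bar>r\<bar> / sqrt (1 + t\<^sup>2)\<close> from the first substitution
  and \<open>1 / sqrt (1 + t\<^sup>2)\<close> from the second.\<close>

lemma nn_integral_polar:
  fixes f :: "real \<Rightarrow> real \<Rightarrow> ennreal"
  assumes [measurable]: "(\<lambda>(x, y). f x y) \<in> borel_measurable (borel \<Otimes>\<^sub>M borel)"
  shows "(\<integral>\<^sup>+x. \<integral>\<^sup>+y. f x y \<partial>lborel \<partial>lborel)
    = (\<integral>\<^sup>+r. \<integral>\<^sup>+t. ennreal (\<bar>r\<bar> / (1 + t\<^sup>2)) * f (r / sqrt (1 + t\<^sup>2)) (r * t / sqrt (1 + t\<^sup>2)) \<partial>lborel \<partial>lborel)"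
proof -
  have "(\<integral>\<^sup>+x. \<integral>\<^sup>+y. f x y \<partial>lborel \<partial>lborel) = (\<integral>\<^sup>+x. \<integral>\<^sup>+t. ennreal \<bar>x\<bar> * f x (x * t) \<partial>lborel \<partial>lborel)"
  \<comment> \<open>The substitution \<open>y = x * t\<close> degenerates on the axis
    \<open>x = 0\<close>, which is a null set.\<close>
  proof (rule nn_integral_cong_AE, rule AE_mp[OF AE_lborel_singleton[of 0]], rule AE_I2, intro impI)
    fix x :: real assume "x \<noteq> 0"
    then show "(\<integral>\<^sup>+y. f x y \<partial>lborel) = (\<integral>\<^sup>+t. ennreal \<bar>x\<bar> * f x (x * t) \<partial>lborel)"
      using nn_integral_lborel_affine[of "f x" x 0] by simp
  qed
  also have "\<dots> = (\<integral>\<^sup>+t. \<integral>\<^sup>+x. ennreal \<bar>x\<bar> * f x (x * t) \<partial>lborel \<partial>lborel)"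
    by (rule lborel_pair.Fubini') simp
  also have "\<dots> = (\<integral>\<^sup>+t. \<integral>\<^sup>+r. ennreal (\<bar>r\<bar> / (1 + t\<^sup>2)) * f (r / sqrt (1 + t\<^sup>2)) (r * t / sqrt (1 + t\<^sup>2)) \<partial>lborel \<partial>lborel)"
  proof (rule nn_integral_cong)
    fix t :: real
    define w where "w = sqrt (1 + t\<^sup>2)"
    have w: "w > 0" "1 + t\<^sup>2 = w * w" by (simp_all add: w_def add_pos_nonneg)
    have e: "ennreal \<bar>1 / w\<bar> * (ennreal \<bar>0 + 1 / w * r\<bar> * a) = ennreal (\<bar>r\<bar> / (w * w)) * a" for a r
      using w by (simp add: abs_mult field_simps flip: mult.assoc ennreal_mult)
    show "(\<integral>\<^sup>+x. ennreal \<bar>x\<bar> * f x (x * t) \<partial>lborel)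
      = (\<integral>\<^sup>+r. ennreal (\<bar>r\<bar> / (1 + t\<^sup>2)) * f (r / sqrt (1 + t\<^sup>2)) (r * t / sqrt (1 + t\<^sup>2)) \<partial>lborel)"
      using nn_integral_lborel_affine[of "\<lambda>x. ennreal \<bar>x\<bar> * f x (x * t)" "1 / w" 0] w(1)
      unfolding w_def[symmetric] w(2) e by simp
  qed
  also have "\<dots> = (\<integral>\<^sup>+r. \<integral>\<^sup>+t. ennreal (\<bar>r\<bar> / (1 + t\<^sup>2)) * f (r / sqrt (1 + t\<^sup>2)) (r * t / sqrt (1 + t\<^sup>2)) \<partial>lborel \<partial>lborel)"
    by (rule lborel_pair.Fubini') simp
  finally show ?thesis .
qed

text \<open>Reflects the negative half line onto the positive one. Applied to the signed radius,
  this brings the two half planes together at one positive radius.\<close>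

lemma nn_integral_real_fold:
  fixes f :: "real \<Rightarrow> ennreal"
  assumes [measurable]: "f \<in> borel_measurable borel"
  shows "(\<integral>\<^sup>+r. f r \<partial>lborel) = (\<integral>\<^sup>+r. (f r + f (- r)) * indicator {0<..} r \<partial>lborel)"
proof -
  have "(\<integral>\<^sup>+r. f r \<partial>lborel) = (\<integral>\<^sup>+r. f r * indicator {0<..} r + f r * indicator {..<0} r \<partial>lborel)"
    by (rule nn_integral_cong_AE, rule AE_mp[OF AE_lborel_singleton[of 0]], rule AE_I2)
       (auto simp: indicator_def)
  also have "\<dots> = (\<integral>\<^sup>+r. f r * indicator {0<..} r \<partial>lborel) + (\<integral>\<^sup>+r. f r * indicator {..<0} r \<partial>lborel)"
    by (rule nn_integral_add) auto
  also have "(\<integral>\<^sup>+r. f r * indicator {..<0} r \<partial>lborel) = (\<integral>\<^sup>+r. f (- r) * indicator {0<..} r \<partial>lborel)"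
    by (subst nn_integral_real_affine[where c="-1" and t=0]) (auto simp: indicator_def intro!: nn_integral_cong)
  finally show ?thesis by (subst (asm) nn_integral_add[symmetric]) (auto simp: distrib_right)
qed

section \<open>Angles measured by the Cauchy kernel on slopes\<close>

lemma cauchy_kernel_atLeast:
  "(\<integral>\<^sup>+t. ennreal (1 / (1 + t\<^sup>2)) * indicator {T..} t \<partial>lborel) = ennreal (pi / 2 - arctan T)"
proof (rule nn_integral_FTC_atLeast)
  show "DERIV arctan t :> 1 / (1 + t\<^sup>2)" for t
    using DERIV_arctan[of t] by (simp add: divide_inverse)
qed (use tendsto_arctan_at_top in auto)

text \<open>Positivity of \<open>T\<close> keeps the two tails disjoint, and by symmetry they have
  equal mass.\<close>

lemma cauchy_kernel_abs_ge:
  assumes "T > 0"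
  shows "(\<integral>\<^sup>+t. ennreal (1 / (1 + t\<^sup>2)) * indicator {t. T \<le> \<bar>t\<bar>} t \<partial>lborel) = ennreal (pi - 2 * arctan T)"
proof -
  have "(\<integral>\<^sup>+t. ennreal (1 / (1 + t\<^sup>2)) * indicator {t. T \<le> \<bar>t\<bar>} t \<partial>lborel)
    = (\<integral>\<^sup>+t. ennreal (1 / (1 + t\<^sup>2)) * indicator {T..} t + ennreal (1 / (1 + t\<^sup>2)) * indicator {..-T} t \<partial>lborel)"
    using assms by (intro nn_integral_cong) (auto simp: indicator_def abs_if)
  also have "\<dots> = (\<integral>\<^sup>+t. ennreal (1 / (1 + t\<^sup>2)) * indicator {T..} t \<partial>lborel)
      + (\<integral>\<^sup>+t. ennreal (1 / (1 + t\<^sup>2)) * indicator {..-T} t \<partial>lborel)"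
    by (rule nn_integral_add) auto
  also have "(\<integral>\<^sup>+t. ennreal (1 / (1 + t\<^sup>2)) * indicator {..-T} t \<partial>lborel)
      = (\<integral>\<^sup>+t. ennreal (1 / (1 + t\<^sup>2)) * indicator {T..} t \<partial>lborel)"
    by (subst nn_integral_real_affine[where c="-1" and t=0])
       (auto simp: indicator_def intro!: nn_integral_cong)
  finally show ?thesis
    using arctan_ubound[of T] by (simp add: cauchy_kernel_atLeast flip: ennreal_plus)
qed

lemma cauchy_kernel_abs_le:
  assumes "T \<ge> 0"
  shows "(\<integral>\<^sup>+t. ennreal (1 / (1 + t\<^sup>2)) * indicator {t. \<bar>t\<bar> \<le> T} t \<partial>lborel) = ennreal (2 * arctan T)"
proof -
  have "(\<integral>\<^sup>+t. ennreal (1 / (1 + t\<^sup>2)) * indicator {-T..T} t \<partial>lborel) = ennreal (arctan T - arctan (-T))"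
  proof (rule nn_integral_FTC_Icc)
    show "DERIV arctan t :> 1 / (1 + t\<^sup>2)" for t
      using DERIV_arctan[of t] by (simp add: divide_inverse)
  qed (use assms in auto)
  also have "{-T..T} = {t. \<bar>t\<bar> \<le> T}" by auto
  finally show ?thesis by (simp add: arctan_minus)
qed

text \<open>The line is cut at 1 and the lower part is reflected, so both pieces become tails; their
  arctangent terms cancel because \<open>arctan\<close> is odd.\<close>

lemma cauchy_kernel_UNIV:
  "(\<integral>\<^sup>+t. ennreal (1 / (1 + t\<^sup>2)) \<partial>lborel) = ennreal pi"
proof -
  have "(\<integral>\<^sup>+t. ennreal (1 / (1 + t\<^sup>2)) \<partial>lborel)
    = (\<integral>\<^sup>+t. ennreal (1 / (1 + t\<^sup>2)) * indicator {1..} t + ennreal (1 / (1 + t\<^sup>2)) * indicator {..<1} t \<partial>lborel)"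
    by (intro nn_integral_cong) (auto simp: indicator_def)
  also have "\<dots> = (\<integral>\<^sup>+t. ennreal (1 / (1 + t\<^sup>2)) * indicator {1..} t \<partial>lborel)
      + (\<integral>\<^sup>+t. ennreal (1 / (1 + t\<^sup>2)) * indicator {..<1} t \<partial>lborel)"
    by (rule nn_integral_add) auto
  also have "(\<integral>\<^sup>+t. ennreal (1 / (1 + t\<^sup>2)) * indicator {..<1} t \<partial>lborel)
      = (\<integral>\<^sup>+t. ennreal (1 / (1 + t\<^sup>2)) * indicator {-1..} t \<partial>lborel)"
  proof -
    have "(\<integral>\<^sup>+t. ennreal (1 / (1 + t\<^sup>2)) * indicator {..<1} t \<partial>lborel)
      = (\<integral>\<^sup>+t. ennreal (1 / (1 + t\<^sup>2)) * indicator {..<1} (- t) \<partial>lborel)"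
      using nn_integral_lborel_affine[of "\<lambda>t. ennreal (1 / (1 + t\<^sup>2)) * indicator {..<1} t" "-1" 0]
      by simp
    \<comment> \<open>The reflection of \<open>{..<1}\<close> omits the point -1, which is
      null.\<close>
    also have "\<dots> = (\<integral>\<^sup>+t. ennreal (1 / (1 + t\<^sup>2)) * indicator {-1..} t \<partial>lborel)"
      by (rule nn_integral_cong_AE, rule AE_mp[OF AE_lborel_singleton[of "-1"]], rule AE_I2)
         (auto simp: indicator_def)
    finally show ?thesis .
  qed
  finally show ?thesis
    by (simp add: cauchy_kernel_atLeast arctan_minus arctan_one flip: ennreal_plus)
qed

text \<open>\<open>1 / sqrt (1 + t\<^sup>2)\<close> is the cosine of the angle
  \<open>arctan \<bar>t\<bar>\<close>, and the cosine decreases on \<open>[0, pi]\<close>. The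
  condition \<open>0 < K\<close> puts \<open>arccos K\<close> below \<open>pi / 2\<close>, where
  \<open>arctan\<close> inverts \<open>tan\<close>.\<close>

lemma cos_arctan_ge_iff:
  assumes "0 < K" "K \<le> 1"
  shows "K \<le> 1 / sqrt (1 + t\<^sup>2) \<longleftrightarrow> \<bar>t\<bar> \<le> tan (arccos K)"
proof -
  have p: "0 \<le> arccos K" "arccos K < pi / 2" 
    using assms arccos_less_arccos[of 0 K] arccos_lbound[of K] by auto
  have "1 / sqrt (1 + t\<^sup>2) = cos (arctan \<bar>t\<bar>)" by (simp add: cos_arctan)
  moreover have "K = cos (arccos K)" using assms by simp
  ultimately have "K \<le> 1 / sqrt (1 + t\<^sup>2) \<longleftrightarrow> cos (arccos K) \<le> cos (arctan \<bar>t\<bar>)" by simp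
  also have "\<dots> \<longleftrightarrow> arctan \<bar>t\<bar> \<le> arccos K"
    using p arctan_ubound[of "\<bar>t\<bar>"] by (subst cos_mono_le_eq) auto
  also have "\<dots> \<longleftrightarrow> arctan \<bar>t\<bar> \<le> arctan (tan (arccos K))"
    using p by (subst arctan_tan) auto
  finally show ?thesis by (simp add: arctan_le_iff)
qed

lemma cos_arctan_le_iff:
  assumes "0 < K" "K \<le> 1"
  shows "1 / sqrt (1 + t\<^sup>2) \<le> K \<longleftrightarrow> tan (arccos K) \<le> \<bar>t\<bar>"
proof -
  have p: "0 \<le> arccos K" "arccos K < pi / 2" 
    using assms arccos_less_arccos[of 0 K] arccos_lbound[of K] by auto
  have "1 / sqrt (1 + t\<^sup>2) = cos (arctan \<bar>t\<bar>)" by (simp add: cos_arctan)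
  moreover have "K = cos (arccos K)" using assms by simp
  ultimately have "1 / sqrt (1 + t\<^sup>2) \<le> K \<longleftrightarrow> cos (arctan \<bar>t\<bar>) \<le> cos (arccos K)" by simp
  also have "\<dots> \<longleftrightarrow> arccos K \<le> arctan \<bar>t\<bar>"
    using p arctan_ubound[of "\<bar>t\<bar>"] by (subst cos_mono_le_eq) auto
  also have "\<dots> \<longleftrightarrow> arctan (tan (arccos K)) \<le> arctan \<bar>t\<bar>"
    using p by (subst arctan_tan) auto
  finally show ?thesis by (simp add: arctan_le_iff)
qed

text \<open>Outside \<open>[-1, 1]\<close> the library's \<^const>\<open>arccos\<close> has an unspecified value.\<close>

definition clipped_arccos :: "real \<Rightarrow> real" where
  "clipped_arccos K = (if K \<le> -1 then pi else if 1 < K then 0 else arccos K)"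

text \<open>Directions of slope \<open>t\<close> have cosine \<open>1 / sqrt (1 + t\<^sup>2)\<close>
  in the right half plane and its negative in the left one. Together the two integrals measure all
  directions on the full circle whose cosine is at least \<open>K\<close>, an arc symmetric about
  the axis.\<close>

lemma cauchy_kernel_half_planes:
  "(\<integral>\<^sup>+t. ennreal (1 / (1 + t\<^sup>2)) * indicator {t. K \<le> 1 / sqrt (1 + t\<^sup>2)} t \<partial>lborel)
   + (\<integral>\<^sup>+t. ennreal (1 / (1 + t\<^sup>2)) * indicator {t. K \<le> - (1 / sqrt (1 + t\<^sup>2))} t \<partial>lborel)
   = ennreal (2 * clipped_arccos K)"
proof -
  have pos: "0 < 1 / sqrt (1 + t\<^sup>2)" and le1: "1 / sqrt (1 + t\<^sup>2) \<le> 1" for t :: real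
    by (simp_all add: add_pos_nonneg)
  have UNIV: "{t. K \<le> 1 / sqrt (1 + t\<^sup>2)} = UNIV" if "K \<le> 0"
    using that less_imp_le[OF pos] order_trans by blast
  have empty: "{t. K \<le> - (1 / sqrt (1 + t\<^sup>2))} = {}" if "0 \<le> K"
  proof -
    have "\<not> K \<le> - (1 / sqrt (1 + t\<^sup>2))" for t :: real using that pos[of t] by linarith
    then show ?thesis by blast
  qed
  consider "K \<le> -1" | "-1 < K" "K < 0" | "K = 0" | "0 < K" "K \<le> 1" | "1 < K" by linarith
  then show ?thesis
  proof cases
    case 1
    have "K \<le> - (1 / sqrt (1 + t\<^sup>2))" for t :: real using 1 le1[of t] by linarith
    then have "{t. K \<le> - (1 / sqrt (1 + t\<^sup>2))} = UNIV" by blast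
    moreover have "K \<le> 0" using 1 by simp
    ultimately show ?thesis
      unfolding UNIV[OF \<open>K \<le> 0\<close>] using 1 cauchy_kernel_UNIV
      by (simp add: clipped_arccos_def flip: ennreal_plus)
  next
    case 2
    \<comment> \<open>The right half plane counts fully, with mass \<open>pi\<close>. The left one
      gives \<open>pi - 2 * (pi - arccos K)\<close>. The strict bound \<open>-1 < K\<close> makes
      the threshold slope positive, as \<open>cauchy_kernel_abs_ge\<close> requires.\<close>
    have p: "0 < arccos (-K)" "arccos (-K) < pi / 2"
      using 2 arccos_less_arccos[of 0 "-K"] arccos_less_arccos[of "-K" 1] by auto
    have "K \<le> - (1 / sqrt (1 + t\<^sup>2)) \<longleftrightarrow> tan (arccos (-K)) \<le> \<bar>t\<bar>" for t
      using cos_arctan_le_iff[of "-K" t] 2 by linarith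
    then have e: "{t. K \<le> - (1 / sqrt (1 + t\<^sup>2))} = {t. tan (arccos (-K)) \<le> \<bar>t\<bar>}" by blast
    have t: "0 < tan (arccos (-K))" using p by (intro tan_gt_zero)
    have u: "arctan (tan (arccos (-K))) = pi - arccos K"
      using p 2 by (subst arctan_tan) (auto simp: arccos_minus)
    have "clipped_arccos K = arccos K" "K \<le> 0" using 2 by (auto simp: clipped_arccos_def)
    moreover have "pi / 2 \<le> arccos K" using p 2 by (simp add: arccos_minus)
    ultimately show ?thesis
      unfolding e UNIV[OF \<open>K \<le> 0\<close>] cauchy_kernel_abs_ge[OF t] u using cauchy_kernel_UNIV
      by (simp flip: ennreal_plus)
  next
    \<comment> \<open>At \<open>K = 0\<close> the threshold slope would be infinite; exactly the
      right half plane counts.\<close>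
    case 3
    then show ?thesis using UNIV empty cauchy_kernel_UNIV by (simp add: clipped_arccos_def)
  next
    case 4
    have p: "0 \<le> arccos K" "arccos K < pi / 2"
      using 4 arccos_less_arccos[of 0 "K"] arccos_lbound[of K] by auto
    have e: "{t. K \<le> 1 / sqrt (1 + t\<^sup>2)} = {t. \<bar>t\<bar> \<le> tan (arccos K)}"
      using cos_arctan_ge_iff[OF 4] by blast
    have t: "0 \<le> tan (arccos K)"
      using p tan_gt_zero[of "arccos K"] by (cases "arccos K = 0") auto
    have u: "arctan (tan (arccos K)) = arccos K"
      using p by (subst arctan_tan) auto
    have "clipped_arccos K = arccos K" "0 \<le> K" using 4 by (auto simp: clipped_arccos_def)
    then show ?thesis
      unfolding e empty[OF \<open>0 \<le> K\<close>] cauchy_kernel_abs_le[OF t] u by simp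
  next
    case 5
    have "\<not> K \<le> 1 / sqrt (1 + t\<^sup>2)" for t :: real using 5 le1[of t] by linarith
    then have e: "{t. K \<le> 1 / sqrt (1 + t\<^sup>2)} = {}" by blast
    have "0 \<le> K" "clipped_arccos K = 0" using 5 by (auto simp: clipped_arccos_def)
    then show ?thesis unfolding e empty[OF \<open>0 \<le> K\<close>] by simp
  qed
qed

section \<open>The density of the distance from the sub-satellite point\<close>

text \<open>By the law of cosines the two conditions say that the point at radius \<open>r\<close>
  and slope \<open>t\<close>, in the right or left half plane, lies within \<open>\<rho>\<close> of
  the cluster center placed on the positive axis at distance \<open>d\<close>. The sum is therefore
  the angle of the arc of radius \<open>r\<close> inside the cluster; solving for the cosine gives
  the threshold \<open>K\<close>.\<close>

lemma nn_integral_angle_f_M: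
  fixes r d \<rho> :: real
  assumes "0 < r" "0 \<le> d" "0 < \<rho>"
  shows "(\<integral>\<^sup>+t. ennreal (1 / (1 + t\<^sup>2)) * indicator {t. r\<^sup>2 + d\<^sup>2 - 2 * d * r / sqrt (1 + t\<^sup>2) \<le> \<rho>\<^sup>2} t \<partial>lborel)
   + (\<integral>\<^sup>+t. ennreal (1 / (1 + t\<^sup>2)) * indicator {t. r\<^sup>2 + d\<^sup>2 + 2 * d * r / sqrt (1 + t\<^sup>2) \<le> \<rho>\<^sup>2} t \<partial>lborel)
   = ennreal (pi * \<rho>\<^sup>2 * f_M r \<rho> d / r)"
proof (cases "d = 0")
  case True
  have "r\<^sup>2 \<le> \<rho>\<^sup>2 \<longleftrightarrow> r \<le> \<rho>"
    using assms by (simp add: power2_le_iff_abs_le)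
  then show ?thesis
    using True assms cauchy_kernel_UNIV
    by (auto simp: f_M_def simp flip: ennreal_plus)
next
  case False
  then have d: "0 < d" using assms by simp
  define K where "K = (r\<^sup>2 + d\<^sup>2 - \<rho>\<^sup>2) / (2 * d * r)"
  have K: "2 * d * r * K = r\<^sup>2 + d\<^sup>2 - \<rho>\<^sup>2" and dr: "0 < 2 * d * r" using d assms by (simp_all add: K_def)
  have m: "2 * d * r * K \<le> 2 * d * r * a \<longleftrightarrow> K \<le> a" for a
    using dr by (rule mult_le_cancel_left_pos)
  have "r\<^sup>2 + d\<^sup>2 - 2 * d * r / sqrt (1 + t\<^sup>2) \<le> \<rho>\<^sup>2 \<longleftrightarrow> K \<le> 1 / sqrt (1 + t\<^sup>2)" for t
    using K m[of "1 / sqrt (1 + t\<^sup>2)"] by auto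
  moreover have "r\<^sup>2 + d\<^sup>2 + 2 * d * r / sqrt (1 + t\<^sup>2) \<le> \<rho>\<^sup>2 \<longleftrightarrow> K \<le> - (1 / sqrt (1 + t\<^sup>2))" for t
    using K m[of "- (1 / sqrt (1 + t\<^sup>2))"] by auto
  moreover have "2 * clipped_arccos K = pi * \<rho>\<^sup>2 * f_M r \<rho> d / r"
  proof -
    \<comment> \<open>The farthest point of the circle from the cluster center is at distance
      \<open>r + d\<close>: this is the case of a circle wholly inside the cluster.\<close>
    have lower: "K \<le> -1 \<longleftrightarrow> r \<le> \<rho> - d"
    proof -
      have "K \<le> -1 \<longleftrightarrow> (r + d)\<^sup>2 \<le> \<rho>\<^sup>2"
        using m[of "-1"] K by (auto simp: power2_sum algebra_simps)
      also have "\<dots> \<longleftrightarrow> r \<le> \<rho> - d" using assms by (auto simp: power2_le_iff_abs_le)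
      finally show ?thesis .
    qed
    \<comment> \<open>The nearest point is at distance \<open>\<bar>r - d\<bar>\<close>: this is the
      case of a circle that meets the cluster.\<close>
    have upper: "K \<le> 1 \<longleftrightarrow> \<bar>r - d\<bar> \<le> \<rho>"
    proof -
      have "K \<le> 1 \<longleftrightarrow> (r - d)\<^sup>2 \<le> \<rho>\<^sup>2"
        using m[of "1"] K by (auto simp: power2_diff algebra_simps)
      also have "\<dots> \<longleftrightarrow> \<bar>r - d\<bar> \<le> \<rho>" using assms by (auto simp: power2_le_iff_abs_le)
      finally show ?thesis .
    qed
    \<comment> \<open>External tangency. The boundary value \<open>r = d - \<rho>\<close> is
      excluded from the second range of \<open>f_M\<close>, which agrees with
      \<open>arccos 1 = 0\<close>.\<close>
    have one: "K = 1" if "r = d - \<rho>"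
    proof -
      have "r\<^sup>2 + d\<^sup>2 - \<rho>\<^sup>2 = 2 * d * r" unfolding that by (simp add: power2_eq_square algebra_simps)
      then show ?thesis using dr unfolding K_def by (metis divide_self less_irrefl)
    qed
    consider "r \<le> \<rho> - d" | "\<bar>\<rho> - d\<bar> < r" "r \<le> \<rho> + d" | "\<rho> - d < r" "r = d - \<rho>"
      | "\<rho> - d < r" "r < d - \<rho>" | "\<rho> + d < r" by linarith
    then show ?thesis
    proof cases
      case 1
      then show ?thesis using lower assms by (simp add: clipped_arccos_def f_M_def)
    next
      case 2
      have "clipped_arccos K = arccos K" using 2 lower upper by (auto simp: clipped_arccos_def abs_if split: if_splits)
      moreover have "\<not> r \<le> \<rho> - d" using 2 by auto
      ultimately show ?thesis using 2 assms by (simp add: f_M_def K_def mult.commute)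
    next
      case 3
      then show ?thesis using one assms lower by (simp add: clipped_arccos_def f_M_def)
    next
      case 4
      then show ?thesis using upper assms lower by (auto simp: clipped_arccos_def f_M_def)
    next
      case 5
      then show ?thesis using upper assms lower d by (auto simp: clipped_arccos_def f_M_def)
    qed
  qed
  ultimately show ?thesis using cauchy_kernel_half_planes[of K] by simp
qed

text \<open>In the second range \<open>r\<close>, \<open>d\<close> and \<open>\<rho>\<close> satisfy
  the triangle inequalities, and these put the quotient into \<open>[-1, 1]\<close>, where
  \<open>arccos\<close> is nonnegative.\<close>

lemma f_M_nonneg:
  assumes "0 \<le> d" "0 < \<rho>"
  shows "0 \<le> f_M r \<rho> d"
proof -
  have "0 \<le> arccos ((r\<^sup>2 + d\<^sup>2 - \<rho>\<^sup>2) / (2 * d * r))" if r: "\<bar>\<rho> - d\<bar> < r" "r \<le> \<rho> + d"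
  proof -
    have dr: "0 < 2 * d * r" using r assms by (cases "d = 0") auto
    have "(r - d)\<^sup>2 \<le> \<rho>\<^sup>2" "\<rho>\<^sup>2 \<le> (r + d)\<^sup>2" using r assms by (auto simp flip: abs_le_square_iff)
    then have "-1 \<le> (r\<^sup>2 + d\<^sup>2 - \<rho>\<^sup>2) / (2 * d * r)" "(r\<^sup>2 + d\<^sup>2 - \<rho>\<^sup>2) / (2 * d * r) \<le> 1"
      using dr by (simp_all add: pos_le_divide_eq pos_divide_le_eq power2_sum power2_diff algebra_simps)
    then show ?thesis by (rule arccos_lbound)
  qed
  then show ?thesis using assms by (auto simp: f_M_def)
qed

lemma f_M_nonpos_eq_0: "r \<le> 0 \<Longrightarrow> f_M r \<rho> d = 0"
  by (auto simp: f_M_def)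

text \<open>Measurability is inherited from the arc angle \<open>g\<close>, an integral depending
  measurably on the parameter \<open>r\<close>, instead of being traced through the piecewise
  \<open>arccos\<close>.\<close>

lemma borel_measurable_f_M [measurable]:
  assumes "0 \<le> d" "0 < \<rho>"
  shows "(\<lambda>r. f_M r \<rho> d) \<in> borel_measurable borel"
proof -
  define g where "g r =
    (\<integral>\<^sup>+t. ennreal (1 / (1 + t\<^sup>2)) * indicator {t. r\<^sup>2 + d\<^sup>2 - 2 * d * r / sqrt (1 + t\<^sup>2) \<le> \<rho>\<^sup>2} t \<partial>lborel)
   + (\<integral>\<^sup>+t. ennreal (1 / (1 + t\<^sup>2)) * indicator {t. r\<^sup>2 + d\<^sup>2 + 2 * d * r / sqrt (1 + t\<^sup>2) \<le> \<rho>\<^sup>2} t \<partial>lborel)"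
    for r
  have "f_M r \<rho> d = (if 0 < r then r * enn2real (g r) / (pi * \<rho>\<^sup>2) else 0)" for r
    using nn_integral_angle_f_M[of r d \<rho>] f_M_nonneg[of d \<rho> r] f_M_nonpos_eq_0[of r \<rho> d] assms
    by (simp add: g_def)
  moreover have "g \<in> borel_measurable borel"
    unfolding g_def indicator_def by measurable
  ultimately show ?thesis by simp
qed

text \<open>Lebesgue measure is invariant under translation and rotation, so \<open>p\<close> may be
  moved to the origin and \<open>q\<close> to the point \<open>(d, 0)\<close>. In signed polar
  coordinates the radial factor then comes out of the inner integral, which leaves the arc
  angle.\<close>

lemma nn_integral_radial_cball:
  fixes \<phi> :: "real \<Rightarrow> ennreal" and p q :: "real \<times> real"
  assumes [measurable]: "\<phi> \<in> borel_measurable borel" and "0 < \<rho>"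
  shows "(\<integral>\<^sup>+u. \<phi> (dist u p) * indicator (cball q \<rho>) u \<partial>lborel)
    = (\<integral>\<^sup>+r. ennreal (pi * \<rho>\<^sup>2 * f_M r \<rho> (dist p q)) * \<phi> r \<partial>lborel)"
proof -
  define d where "d = dist p q"
  have d0: "0 \<le> d" by (simp add: d_def)
  \<comment> \<open>\<open>(c, s)\<close> is the unit vector from \<open>p\<close> towards
    \<open>q\<close>; if the points coincide, any direction serves.\<close>
  obtain c s where cs: "c\<^sup>2 + s\<^sup>2 = 1" and q: "q = p + d *\<^sub>R (c, s)"
  proof (cases "d = 0")
    case True
    then show ?thesis using that[of 1 0] by (simp add: d_def zero_prod_def[symmetric])
  next
    case False
    define e where "e = (1 / d) *\<^sub>R (q - p)"
    have "norm e = 1" using False by (simp add: e_def d_def dist_norm norm_minus_commute)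
    then have "(fst e)\<^sup>2 + (snd e)\<^sup>2 = 1" by (simp add: norm_prod_def)
    moreover have "q = p + d *\<^sub>R (fst e, snd e)" using False by (simp add: e_def prod_eq_iff)
    ultimately show ?thesis using that by blast
  qed
  \<comment> \<open>The half plane of negative radius is covered by \<open>k (- r)\<close>, since
    \<open>k\<close> depends on the sign of \<open>r\<close> only through the cosine term.\<close>
  define k where "k r = (\<integral>\<^sup>+t. ennreal (1 / (1 + t\<^sup>2)) * indicator {t. r\<^sup>2 + d\<^sup>2 - 2 * d * r / sqrt (1 + t\<^sup>2) \<le> \<rho>\<^sup>2} t \<partial>lborel)" for r
  have [measurable]: "k \<in> borel_measurable borel"
    unfolding k_def indicator_def by measurable
  have [measurable]: "cball q \<rho> \<in> sets borel" by (simp add: borel_closed)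
  have meas: "(\<lambda>u. \<phi> (dist u p) * indicator (cball q \<rho>) u) \<in> borel_measurable borel"
    by measurable
  have "(\<integral>\<^sup>+u. \<phi> (dist u p) * indicator (cball q \<rho>) u \<partial>lborel)
    = (\<integral>\<^sup>+u. \<phi> (dist u p) * indicator (cball q \<rho>) u \<partial>distr lborel borel ((+) p))"
    by (simp add: lborel_distr_plus)
  also have "\<dots> = (\<integral>\<^sup>+z. \<phi> (norm z) * indicator (cball q \<rho>) (p + z) \<partial>lborel)"
    using meas by (subst nn_integral_distr) (simp_all add: dist_norm)
  also have "\<dots> = (\<integral>\<^sup>+x. \<integral>\<^sup>+y. \<phi> (norm (c * x - s * y, s * x + c * y))
      * indicator (cball q \<rho>) (p + (c * x - s * y, s * x + c * y)) \<partial>lborel \<partial>lborel)"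
    using cs by (intro nn_integral_rotate) simp_all
  also have "\<dots> = (\<integral>\<^sup>+x. \<integral>\<^sup>+y. \<phi> (sqrt (x\<^sup>2 + y\<^sup>2))
      * indicator {z. (fst z - d)\<^sup>2 + (snd z)\<^sup>2 \<le> \<rho>\<^sup>2} (x, y) \<partial>lborel \<partial>lborel)"
  proof (intro nn_integral_cong arg_cong2[where f="(*)"] arg_cong[where f=\<phi>])
    fix x y :: real
    \<comment> \<open>Used at \<open>(x, y)\<close> for the distance to \<open>p\<close> and at
      \<open>(x - d, y)\<close> for the distance to \<open>q\<close>.\<close>
    have rot: "(c * x - s * y)\<^sup>2 + (s * x + c * y)\<^sup>2 = x\<^sup>2 + y\<^sup>2" for x y
    proof -
      have "(c * x - s * y)\<^sup>2 + (s * x + c * y)\<^sup>2 = (c\<^sup>2 + s\<^sup>2) * (x\<^sup>2 + y\<^sup>2)"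
        by (simp add: power2_eq_square algebra_simps)
      then show ?thesis using cs by simp
    qed
    show "norm (c * x - s * y, s * x + c * y) = sqrt (x\<^sup>2 + y\<^sup>2)"
      by (simp add: norm_prod_def rot)
    have "dist q (p + (c * x - s * y, s * x + c * y))
      = norm (c * (x - d) - s * y, s * (x - d) + c * y)"
      by (subst dist_commute) (simp add: dist_norm q algebra_simps)
    also have "\<dots> = sqrt ((x - d)\<^sup>2 + y\<^sup>2)"
      using rot[of "x - d" y] by (simp add: norm_prod_def)
    finally have "dist q (p + (c * x - s * y, s * x + c * y)) \<le> \<rho> \<longleftrightarrow> (x - d)\<^sup>2 + y\<^sup>2 \<le> \<rho>\<^sup>2"
      using \<open>0 < \<rho>\<close> real_sqrt_le_iff[of "(x - d)\<^sup>2 + y\<^sup>2" "\<rho>\<^sup>2"] by simp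
    then show "indicator (cball q \<rho>) (p + (c * x - s * y, s * x + c * y))
      = (indicator {z. (fst z - d)\<^sup>2 + (snd z)\<^sup>2 \<le> \<rho>\<^sup>2} (x, y) :: ennreal)"
      by (simp add: indicator_def)
  qed
  also have "\<dots> = (\<integral>\<^sup>+r. \<integral>\<^sup>+t. ennreal (\<bar>r\<bar> / (1 + t\<^sup>2)) *
      (\<phi> (sqrt ((r / sqrt (1 + t\<^sup>2))\<^sup>2 + (r * t / sqrt (1 + t\<^sup>2))\<^sup>2))
      * indicator {z. (fst z - d)\<^sup>2 + (snd z)\<^sup>2 \<le> \<rho>\<^sup>2} (r / sqrt (1 + t\<^sup>2), r * t / sqrt (1 + t\<^sup>2))) \<partial>lborel \<partial>lborel)"
    by (intro nn_integral_polar) (simp add: indicator_def)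
  also have "\<dots> = (\<integral>\<^sup>+r. \<integral>\<^sup>+t. (ennreal \<bar>r\<bar> * \<phi> \<bar>r\<bar>) * (ennreal (1 / (1 + t\<^sup>2))
      * indicator {t. r\<^sup>2 + d\<^sup>2 - 2 * d * r / sqrt (1 + t\<^sup>2) \<le> \<rho>\<^sup>2} t) \<partial>lborel \<partial>lborel)"
  proof (intro nn_integral_cong)
    fix r t :: real
    define w where "w = sqrt (1 + t\<^sup>2)"
    have w: "0 < w" "w\<^sup>2 = 1 + t\<^sup>2" by (simp_all add: w_def add_pos_nonneg)
    have e: "(r / w)\<^sup>2 + (r * t / w)\<^sup>2 = r\<^sup>2"
    proof -
      have "(r / w)\<^sup>2 + (r * t / w)\<^sup>2 = r\<^sup>2 * (1 + t\<^sup>2) / w\<^sup>2"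
        by (simp add: power_divide power_mult_distrib add_divide_distrib algebra_simps)
      then show ?thesis unfolding w(2)[symmetric] using w(1) by simp
    qed
    have "(r / w - d)\<^sup>2 + (r * t / w)\<^sup>2 = r\<^sup>2 + d\<^sup>2 - 2 * d * r / w"
    proof -
      have "(r / w - d)\<^sup>2 = (r / w)\<^sup>2 + d\<^sup>2 - 2 * d * r / w"
        by (subst power2_diff) simp
      then show ?thesis using e by linarith
    qed
    then have i: "indicator {z. (fst z - d)\<^sup>2 + (snd z)\<^sup>2 \<le> \<rho>\<^sup>2} (r / w, r * t / w)
      = (indicator {t. r\<^sup>2 + d\<^sup>2 - 2 * d * r / sqrt (1 + t\<^sup>2) \<le> \<rho>\<^sup>2} t :: ennreal)"
      by (simp add: indicator_def w_def)
    have "ennreal (\<bar>r\<bar> / (1 + t\<^sup>2)) = ennreal \<bar>r\<bar> * ennreal (1 / (1 + t\<^sup>2))"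
      by (simp flip: ennreal_mult)
    then show "ennreal (\<bar>r\<bar> / (1 + t\<^sup>2)) *
      (\<phi> (sqrt ((r / sqrt (1 + t\<^sup>2))\<^sup>2 + (r * t / sqrt (1 + t\<^sup>2))\<^sup>2))
      * indicator {z. (fst z - d)\<^sup>2 + (snd z)\<^sup>2 \<le> \<rho>\<^sup>2} (r / sqrt (1 + t\<^sup>2), r * t / sqrt (1 + t\<^sup>2)))
      = (ennreal \<bar>r\<bar> * \<phi> \<bar>r\<bar>) * (ennreal (1 / (1 + t\<^sup>2))
      * indicator {t. r\<^sup>2 + d\<^sup>2 - 2 * d * r / sqrt (1 + t\<^sup>2) \<le> \<rho>\<^sup>2} t)"
      unfolding w_def[symmetric] e i by (simp add: ac_simps)
  qed
  also have "\<dots> = (\<integral>\<^sup>+r. ennreal \<bar>r\<bar> * \<phi> \<bar>r\<bar> * k r \<partial>lborel)"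
    unfolding k_def by (intro nn_integral_cong nn_integral_cmult) (simp add: indicator_def)
  also have "\<dots> = (\<integral>\<^sup>+r. (ennreal \<bar>r\<bar> * \<phi> \<bar>r\<bar> * k r + ennreal \<bar>- r\<bar> * \<phi> \<bar>- r\<bar> * k (- r)) * indicator {0<..} r \<partial>lborel)"
    by (rule nn_integral_real_fold) simp
  also have "\<dots> = (\<integral>\<^sup>+r. ennreal (pi * \<rho>\<^sup>2 * f_M r \<rho> d) * \<phi> r \<partial>lborel)"
  proof (intro nn_integral_cong)
    fix r :: real
    show "(ennreal \<bar>r\<bar> * \<phi> \<bar>r\<bar> * k r + ennreal \<bar>- r\<bar> * \<phi> \<bar>- r\<bar> * k (- r)) * indicator {0<..} r
      = ennreal (pi * \<rho>\<^sup>2 * f_M r \<rho> d) * \<phi> r"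
    proof (cases "0 < r")
      case True
      then have "k r + k (- r) = ennreal (pi * \<rho>\<^sup>2 * f_M r \<rho> d / r)"
        using nn_integral_angle_f_M[of r d \<rho>] d0 assms(2) by (simp add: k_def)
      moreover have "ennreal (pi * \<rho>\<^sup>2 * f_M r \<rho> d) = ennreal r * ennreal (pi * \<rho>\<^sup>2 * f_M r \<rho> d / r)"
        using True f_M_nonneg[of d \<rho> r] d0 assms(2) by (simp flip: ennreal_mult)
      ultimately show ?thesis
        using True by (simp add: distrib_left[symmetric] ac_simps)
    next
      case False
      then show ?thesis by (simp add: f_M_nonpos_eq_0)
    qed
  qed
  finally show ?thesis by (simp add: d_def)
qed

section \<open>The change of variable between distance and Doppler magnitude\<close>

text \<open>The map inverts \<open>A * z / sqrt (h\<^sup>2 + z\<^sup>2)\<close>, and its derivative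
  is the Jacobian factor in \<open>f_chi_M\<close>.\<close>

lemma DERIV_scaled_cos_inverse:
  fixes h A x :: real
  assumes "\<bar>x\<bar> < A"
  shows "((\<lambda>x. h * x / sqrt (A\<^sup>2 - x\<^sup>2)) has_real_derivative h * A\<^sup>2 / (A\<^sup>2 - x\<^sup>2) powr (3/2)) (at x)"
proof -
  define y where "y = A\<^sup>2 - x\<^sup>2"
  have y: "0 < y" using power_strict_mono[of "\<bar>x\<bar>" A 2] assms by (simp add: y_def)
  have p: "y powr (3/2) = y * sqrt y"
    using y powr_add[of y 1 "1/2"] by (simp add: powr_half_sqrt)
  have "((\<lambda>x. h * x / sqrt (A\<^sup>2 - x\<^sup>2)) has_real_derivative
      (h * sqrt y - h * x * (- 2 * x * (inverse (sqrt y) / 2))) / (sqrt y * sqrt y)) (at x)"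
    using y unfolding y_def by (auto intro!: derivative_eq_intros)
  also have "(h * sqrt y - h * x * (- 2 * x * (inverse (sqrt y) / 2))) / (sqrt y * sqrt y) = h * A\<^sup>2 / (y * sqrt y)"
  proof -
    have "(h * sqrt y - h * x * (- 2 * x * (inverse (sqrt y) / 2))) / (sqrt y * sqrt y)
      = (h * (sqrt y * sqrt y) + h * x\<^sup>2) / (y * sqrt y)"
      using y by (simp add: field_simps power2_eq_square)
    also have "h * (sqrt y * sqrt y) + h * x\<^sup>2 = h * A\<^sup>2"
      using y by (simp add: y_def algebra_simps)
    finally show ?thesis .
  qed
  finally show ?thesis unfolding y_def p[unfolded y_def] .
qed

text \<open>Substitution by \<open>g\<close> on \<open>[0, a]\<close>. The strict bound
  \<open>a < A\<close> keeps the derivative continuous on the closed interval, because it blows up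
  at \<open>A\<close>.\<close>

lemma nn_integral_f_chi_M:
  assumes "0 < h" "0 < \<rho>" "0 \<le> d" "0 \<le> a" "a < A"
  shows "(\<integral>\<^sup>+x. ennreal (f_chi_M h A \<rho> d x) * indicator {..a} x \<partial>lborel)
    = (\<integral>\<^sup>+r. ennreal (f_M r \<rho> d) * indicator {..h * a / sqrt (A\<^sup>2 - a\<^sup>2)} r \<partial>lborel)"
proof -
  define g where "g x = h * x / sqrt (A\<^sup>2 - x\<^sup>2)" for x
  note [measurable] = borel_measurable_f_M[OF assms(3,2)]
  have pos: "0 < A\<^sup>2 - x\<^sup>2" if "x \<in> {0..a}" for x
    using that assms by (simp add: power_strict_mono)
  \<comment> \<open>Since \<open>g 0 = 0\<close> and \<open>f_M\<close> vanishes for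
    \<open>r \<le> 0\<close>, the half line can be cut to a compact interval.\<close>
  have "(\<integral>\<^sup>+r. ennreal (f_M r \<rho> d) * indicator {..g a} r \<partial>lborel)
    = (\<integral>\<^sup>+r. ennreal (f_M r \<rho> d) * indicator {g 0..g a} r \<partial>lborel)"
    by (intro nn_integral_cong) (auto simp: indicator_def g_def f_M_nonpos_eq_0)
  also have "\<dots> = (\<integral>\<^sup>+x. ennreal (f_M (g x) \<rho> d * (h * A\<^sup>2 / (A\<^sup>2 - x\<^sup>2) powr (3/2))) * indicator {0..a} x \<partial>lborel)"
    unfolding nn_integral_set_ennreal
  proof (rule nn_integral_substitution[where g=g and f="\<lambda>r. f_M r \<rho> d"])
    show "set_borel_measurable borel {g 0..g a} (\<lambda>r. f_M r \<rho> d)"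
      unfolding set_borel_measurable_def by measurable
    show "(g has_real_derivative h * A\<^sup>2 / (A\<^sup>2 - x\<^sup>2) powr (3/2)) (at x)" if "x \<in> {0..a}" for x
      unfolding g_def using that assms by (intro DERIV_scaled_cos_inverse) auto
    show "continuous_on {0..a} (\<lambda>x. h * A\<^sup>2 / (A\<^sup>2 - x\<^sup>2) powr (3/2))"
      using pos by (intro continuous_intros) (auto dest!: pos)
  qed (use assms in auto)
  also have "\<dots> = (\<integral>\<^sup>+x. ennreal (f_chi_M h A \<rho> d x) * indicator {..a} x \<partial>lborel)"
  proof (intro nn_integral_cong)
    fix x
    show "ennreal (f_M (g x) \<rho> d * (h * A\<^sup>2 / (A\<^sup>2 - x\<^sup>2) powr (3/2))) * indicator {0..a} x
      = ennreal (f_chi_M h A \<rho> d x) * indicator {..a} x"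
      using assms by (auto simp: f_chi_M_def g_def indicator_def mult.commute)
  qed
  finally show ?thesis by (simp add: g_def)
qed

text \<open>Both sides are nonnegative, so the inequality may be squared and solved for
  \<open>z\<close>.\<close>

lemma scaled_cos_le_iff:
  fixes A a h z :: real
  assumes "0 < h" "0 \<le> z" "0 \<le> a" "a < A"
  shows "A * z / sqrt (h\<^sup>2 + z\<^sup>2) \<le> a \<longleftrightarrow> z \<le> h * a / sqrt (A\<^sup>2 - a\<^sup>2)"
proof -
  have p: "0 < h\<^sup>2 + z\<^sup>2" "0 < A\<^sup>2 - a\<^sup>2"
    using assms by (simp_all add: power_strict_mono add_pos_nonneg)
  have "A * z / sqrt (h\<^sup>2 + z\<^sup>2) \<le> a \<longleftrightarrow> A * z \<le> a * sqrt (h\<^sup>2 + z\<^sup>2)"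
    using p by (simp add: pos_divide_le_eq)
  also have "\<dots> \<longleftrightarrow> (A * z)\<^sup>2 \<le> (a * sqrt (h\<^sup>2 + z\<^sup>2))\<^sup>2"
    using assms p by (subst power2_le_iff_abs_le) (auto simp: abs_mult)
  also have "\<dots> \<longleftrightarrow> (z * sqrt (A\<^sup>2 - a\<^sup>2))\<^sup>2 \<le> (h * a)\<^sup>2"
    using p by (simp add: power_mult_distrib algebra_simps)
  also have "\<dots> \<longleftrightarrow> z * sqrt (A\<^sup>2 - a\<^sup>2) \<le> h * a"
    using assms p by (subst power2_le_iff_abs_le) (auto simp: abs_mult)
  also have "\<dots> \<longleftrightarrow> z \<le> h * a / sqrt (A\<^sup>2 - a\<^sup>2)"
    using p by (simp add: pos_le_divide_eq)
  finally show ?thesis .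
qed

lemma scaled_cos_less:
  fixes A h z :: real
  assumes "0 < h" "0 \<le> z" "0 < A"
  shows "A * z / sqrt (h\<^sup>2 + z\<^sup>2) < A"
proof -
  have "z < sqrt (h\<^sup>2 + z\<^sup>2)" using assms by (intro real_less_rsqrt) simp
  then show ?thesis using assms by (simp add: add_pos_nonneg pos_divide_less_eq)
qed

section \<open>The law of the Doppler magnitude, by comparison of distribution functions\<close>

theorem corollary2:
  fixes M :: "'w measure" and UE :: "'w \<Rightarrow> plane"
    and p q :: plane
    and f\<^sub>c c r\<^sub>E r\<^sub>o h \<rho> \<omega>\<^sub>s \<omega>\<^sub>E \<omega>\<^sub>F \<theta>\<^sub>i s Rh A :: real
  assumes "prob_space M"
    and "f\<^sub>c > 0" and "c > 0" and "r\<^sub>E > 0" and "h > 0" and "\<rho> > 0"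
    and "\<omega>\<^sub>s > 0" and "\<omega>\<^sub>E > 0"
    and "\<omega>\<^sub>F = \<omega>\<^sub>s + \<omega>\<^sub>E * cos \<theta>\<^sub>i" and "\<omega>\<^sub>F > 0"
    and "r\<^sub>o = r\<^sub>E + h"
    and "A = f\<^sub>c * r\<^sub>o * (\<omega>\<^sub>s + \<omega>\<^sub>E * cos \<theta>\<^sub>i) / c"
    and "s = slant_range p h q"
    and "Rh = sqrt (s\<^sup>2 - h\<^sup>2)"
    and "distributed M lborel UE
           (\<lambda>u. indicator (cball q \<rho>) u / measure lborel (cball q \<rho>))"
  shows "(\<forall>x. f_chi_M h A \<rho> Rh x \<ge> 0) \<and>
    distributed M lborel (\<lambda>w. doppler_magnitude f\<^sub>c c r\<^sub>E \<omega>\<^sub>F h p (UE w)) (f_chi_M h A \<rho> Rh)"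
proof -
  interpret prob_space M by fact
  note UE = assms(15)
  have h: "0 < h" and \<rho>: "0 < \<rho>" by fact+
  have A: "0 < A"
    using assms(2-5,9,10,11) by (simp add: assms(12))
  \<comment> \<open>Pythagoras: the vertical leg of the slant range is \<open>h\<close>.\<close>
  have Rh: "Rh = dist p q"
    by (simp add: assms(13,14) slant_range_def dist_prod_def)
  then have Rh0: "0 \<le> Rh" by simp
  note fM [measurable] = borel_measurable_f_M[OF Rh0 \<rho>]
  have [measurable]: "cball q \<rho> \<in> sets borel" by (simp add: borel_closed)
  have area: "measure lborel (cball q \<rho>) = pi * \<rho>\<^sup>2"
    using content_cball[of \<rho> q] \<rho> by (simp add: unit_ball_vol_2 power2_eq_square)
  define D where "D w = dist (UE w) p" for w
  define Y where "Y w = doppler_magnitude f\<^sub>c c r\<^sub>E \<omega>\<^sub>F h p (UE w)" for w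
  have Y: "Y w = A * D w / sqrt (h\<^sup>2 + (D w)\<^sup>2)" for w
  proof -
    \<comment> \<open>The earth radius cancels between the Doppler prefactor and the elevation
      cosine, which leaves the amplitude \<open>A\<close>.\<close>
    have "f\<^sub>c * r\<^sub>E * \<omega>\<^sub>F / c * (r\<^sub>o * z / (r\<^sub>E * v)) = f\<^sub>c * r\<^sub>o * \<omega>\<^sub>F / c * z / v" for z v
      using assms(4) by simp
    then show ?thesis
      unfolding Y_def D_def doppler_magnitude_def cos_elevation_def assms(12) assms(9,11)[symmetric] .
  qed
  have Y_nonneg: "0 \<le> Y w" for w using A by (simp add: Y D_def)
  have Y_less: "Y w < A" for w
    unfolding Y using h A by (intro scaled_cos_less) (simp_all add: D_def)
  have UEm: "UE \<in> borel_measurable M"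
    using distributed_measurable[OF UE] by simp
  have [measurable]: "D \<in> borel_measurable M"
    unfolding D_def using UEm by measurable
  have [measurable]: "Y \<in> borel_measurable M"
    unfolding Y by measurable
  have chi0: "0 \<le> f_chi_M h A \<rho> Rh x" for x
    using h f_M_nonneg[OF Rh0 \<rho>] by (simp add: f_chi_M_def)
  have chim [measurable]: "f_chi_M h A \<rho> Rh \<in> borel_measurable borel"
    unfolding f_chi_M_def by measurable

  \<comment> \<open>The uniform law contributes \<open>1 / (pi * \<rho>\<^sup>2)\<close>, which
    cancels the area factor of \<open>nn_integral_radial_cball\<close>, applied to the indicator of
    \<open>{..b}\<close>.\<close>
  have radial: "emeasure M {w \<in> space M. D w \<le> b} = (\<integral>\<^sup>+r. ennreal (f_M r \<rho> Rh) * indicator {..b} r \<partial>lborel)" for b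
  proof -
    have "emeasure M {w \<in> space M. D w \<le> b} = (\<integral>\<^sup>+w. indicator {u. dist u p \<le> b} (UE w) \<partial>M)"
      by (subst nn_integral_indicator[symmetric], measurable)
         (auto intro!: nn_integral_cong simp: D_def indicator_def)
    also have "\<dots> = (\<integral>\<^sup>+u. ennreal (indicator (cball q \<rho>) u / measure lborel (cball q \<rho>))
        * indicator {u. dist u p \<le> b} u \<partial>lborel)"
      by (rule distributed_nn_integral[OF UE, symmetric]) simp
    also have "\<dots> = (\<integral>\<^sup>+u. ennreal (1 / (pi * \<rho>\<^sup>2))
        * (indicator {..b} (dist u p) * indicator (cball q \<rho>) u) \<partial>lborel)"
      by (intro nn_integral_cong) (auto simp: area indicator_def)
    also have "\<dots> = ennreal (1 / (pi * \<rho>\<^sup>2))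
        * (\<integral>\<^sup>+u. indicator {..b} (dist u p) * indicator (cball q \<rho>) u \<partial>lborel)"
      by (rule nn_integral_cmult) simp
    also have "(\<integral>\<^sup>+u. indicator {..b} (dist u p) * indicator (cball q \<rho>) u \<partial>lborel)
        = (\<integral>\<^sup>+r. ennreal (pi * \<rho>\<^sup>2 * f_M r \<rho> Rh) * indicator {..b} r \<partial>lborel)"
      unfolding Rh using \<rho> by (intro nn_integral_radial_cball) simp_all
    also have "ennreal (1 / (pi * \<rho>\<^sup>2)) * \<dots>
        = (\<integral>\<^sup>+r. ennreal (1 / (pi * \<rho>\<^sup>2)) * (ennreal (pi * \<rho>\<^sup>2 * f_M r \<rho> Rh) * indicator {..b} r) \<partial>lborel)"
      by (rule nn_integral_cmult[symmetric]) simp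
    also have "\<dots> = (\<integral>\<^sup>+r. ennreal (f_M r \<rho> Rh) * indicator {..b} r \<partial>lborel)"
      using \<rho> f_M_nonneg[OF Rh0 \<rho>]
      by (intro nn_integral_cong) (simp flip: mult.assoc ennreal_mult)
    finally show ?thesis .
  qed

  let ?\<mu> = "density lborel (f_chi_M h A \<rho> Rh)"
  let ?\<nu> = "distr M lborel Y"
  have sub: "emeasure ?\<mu> {..a} = emeasure ?\<nu> {..a}" if "0 \<le> a" "a < A" for a
  proof -
    have "emeasure ?\<nu> {..a} = emeasure M {w \<in> space M. D w \<le> h * a / sqrt (A\<^sup>2 - a\<^sup>2)}"
      using scaled_cos_le_iff[OF h _ that]
      by (subst emeasure_distr) (auto intro!: arg_cong[where f="emeasure M"] simp: Y D_def)
    then show ?thesis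
      using nn_integral_f_chi_M[OF h \<rho> Rh0 that] by (simp add: emeasure_density radial)
  qed
  \<comment> \<open>The substitution breaks down at \<open>A\<close>, so \<open>{..<A}\<close> is
    exhausted by the half lines \<open>B n\<close>. Their end points start at 0 and stay below
    \<open>A\<close>, hence \<open>sub\<close> covers each of them.\<close>
  have lim: "emeasure ?\<mu> {..<A} = emeasure ?\<nu> {..<A}"
  proof -
    define B where "B n = {..A - A / real (Suc n)}" for n
    have "incseq B"
    proof (rule incseq_SucI)
      fix n
      have "A / real (Suc (Suc n)) \<le> A / real (Suc n)"
        using A by (intro divide_left_mono) simp_all
      then show "B n \<subseteq> B (Suc n)" by (auto simp: B_def)
    qed
    moreover have "(\<Union>n. B n) = {..<A}"
    proof (intro set_eqI iffI)
      fix x assume "x \<in> {..<A}"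
      then have "0 < (A - x) / A" using A by simp
      then obtain n where "inverse (real (Suc n)) < (A - x) / A" using reals_Archimedean by blast
      then have "x \<le> A - A / real (Suc n)" using A by (simp add: field_simps)
      then show "x \<in> (\<Union>n. B n)" by (auto simp: B_def)
    next
      fix x assume "x \<in> (\<Union>n. B n)"
      then obtain n where "x \<le> A - A / real (Suc n)" by (auto simp: B_def)
      moreover have "0 < A / real (Suc n)" using A by simp
      ultimately show "x \<in> {..<A}" by simp
    qed
    moreover have "emeasure ?\<mu> (B n) = emeasure ?\<nu> (B n)" for n
      unfolding B_def using A by (intro sub) (simp_all add: field_simps)
    ultimately show ?thesis
      using SUP_emeasure_incseq[of B ?\<mu>] SUP_emeasure_incseq[of B ?\<nu>]
      by (simp add: B_def image_subset_iff)
  qed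
  \<comment> \<open>Below 0 both measures vanish. From \<open>A\<close> on nothing is added to
    \<open>{..<A}\<close>: the density is 0 there, and \<open>Y\<close> never reaches
    \<open>A\<close>.\<close>
  have eq: "emeasure ?\<mu> {..a} = emeasure ?\<nu> {..a}" for a
  proof -
    consider "a < 0" | "0 \<le> a" "a < A" | "A \<le> a" by linarith
    then show ?thesis
    proof cases
      case 1
      have "emeasure ?\<mu> {..a} = (\<integral>\<^sup>+x. ennreal (f_chi_M h A \<rho> Rh x) * indicator {..a} x \<partial>lborel)"
        by (simp add: emeasure_density)
      also have "\<dots> = (\<integral>\<^sup>+(x::real). 0 \<partial>lborel)"
        using 1 by (intro nn_integral_cong) (auto simp: f_chi_M_def indicator_def)
      finally have "emeasure ?\<mu> {..a} = 0" by simp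
      moreover have "Y -` {..a} = {}"
      proof -
        have "\<not> Y w \<le> a" for w using Y_nonneg[of w] 1 by linarith
        then show ?thesis by auto
      qed
      ultimately show ?thesis by (simp add: emeasure_distr)
    next
      case 3
      have "emeasure ?\<mu> {..a} = (\<integral>\<^sup>+x. ennreal (f_chi_M h A \<rho> Rh x) * indicator {..a} x \<partial>lborel)"
        by (simp add: emeasure_density)
      also have "\<dots> = (\<integral>\<^sup>+x. ennreal (f_chi_M h A \<rho> Rh x) * indicator {..<A} x \<partial>lborel)"
        using 3 by (intro nn_integral_cong) (auto simp: f_chi_M_def indicator_def)
      also have "\<dots> = emeasure ?\<mu> {..<A}"
        by (simp add: emeasure_density)
      finally have "emeasure ?\<mu> {..a} = emeasure ?\<mu> {..<A}" .
      moreover have "Y -` {..a} = Y -` {..<A}"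
      proof -
        have "Y w \<le> a \<longleftrightarrow> Y w < A" for w using Y_less[of w] 3 by linarith
        then show ?thesis by auto
      qed
      ultimately show ?thesis using lim by (simp add: emeasure_distr)
    qed (rule sub)
  qed
  have "distributed M lborel Y (f_chi_M h A \<rho> Rh)"
  proof (rule distributedI_borel_atMost[where g="\<lambda>a. measure M (Y -` {..a} \<inter> space M)"])
    fix a
    have "{w \<in> space M. Y w \<le> a} = Y -` {..a} \<inter> space M" by auto
    then show "emeasure M {w \<in> space M. Y w \<le> a} = ennreal (measure M (Y -` {..a} \<inter> space M))"
      by (simp add: emeasure_eq_measure)
    show "(\<integral>\<^sup>+x. ennreal (f_chi_M h A \<rho> Rh x * indicator {..a} x) \<partial>lborel)
        = ennreal (measure M (Y -` {..a} \<inter> space M))"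
      using eq[of a]
      by (simp add: emeasure_density emeasure_distr emeasure_eq_measure flip: nn_integral_set_ennreal)
  qed (use chi0 in auto)
  then show ?thesis using chi0 by (simp add: Y_def[abs_def])
qed

end
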